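(* For every fixed $\beta\ge 0$ and every fixed $z\in\mathbb{C}$, the Mittag-Leffler function $E_{\alpha,\beta}(z)$ is differentiable as a function of the real variable $\alpha\in(0,\infty)$, and for all $\alpha>0$ $$\frac{\partial E_{\alpha,\beta}(z)}{\partial \alpha} = - \sum_{k=1}^{\infty} \frac{k\, \psi(\alpha k + \beta)}{\Gamma(\alpha k + \beta)}\, z^k .$$
   Context: The two-parametric Mittag-Leffler function is $E_{\alpha,\beta}(z)=\sum_{k=0}^{\infty}\frac{z^k}{\Gamma(\alpha k+\beta)}$, where $1/\Gamma$ is understood as an entire function (equal to $0$ at $0,-1,-2,\dots$). $\psi=\Gamma'/\Gamma$ is the digamma function. *)

theory Defs
  imports "HOL-Analysis.Analysis"
begin

text \<open>
  \<^const>\<open>rGamma\<close> is the entire function \<open>1/\<Gamma>\<close>, with value \<open>0\<close> at \<open>0, -1, -2, \<dots>\<close>.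
\<close>
definition mittag_leffler :: "complex \<Rightarrow> complex \<Rightarrow> complex \<Rightarrow> complex" where
  "mittag_leffler \<alpha> \<beta> z = (\<Sum>k. z ^ k * rGamma (\<alpha> * of_nat k + \<beta>))"

text \<open>
  Only used for \<open>k \<ge> 1\<close>, \<open>\<alpha> > 0\<close> and \<open>\<beta> \<ge> 0\<close>, where \<open>\<alpha>k + \<beta>\<close> is positive and hence not a pole of
  \<open>\<psi>\<close> or \<open>\<Gamma>\<close>.
\<close>
definition ml_deriv_term :: "real \<Rightarrow> real \<Rightarrow> complex \<Rightarrow> nat \<Rightarrow> complex" where
  "ml_deriv_term \<alpha> \<beta> z k =
     of_nat k * Digamma (complex_of_real (\<alpha> * real k + \<beta>))
       / Gamma (complex_of_real (\<alpha> * real k + \<beta>)) * z ^ k"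

end

theory Submission
  imports Defs
begin

text \<open>
  Since \<open>\<psi> = (ln \<Gamma>)'\<close> increases to infinity, \<open>1/\<Gamma>(x)\<close> decays faster than every \<open>exp (-R x)\<close>, and as
  \<open>\<psi>(x) \<le> ln x\<close>, so does \<open>\<psi>(x)/\<Gamma>(x)\<close>. Hence the termwise derivatives are dominated, uniformly in
  \<open>a \<ge> \<alpha>/2\<close>, by a convergent geometric series, and the series may be differentiated term by term.
\<close>

text \<open>Here the derivatives are the linear maps \<open>h *\<^sub>R f' n x\<close>. The error of
  their partial sums factors as \<open>\<bar>h\<bar>\<close> times the distance of
  \<open>\<Sum>i<n. f' i x\<close> from its limit, so uniform convergence of the latter is all that
  termwise differentiation requires.\<close>

lemma has_vector_derivative_series:
  fixes f :: "nat \<Rightarrow> real \<Rightarrow> 'b :: banach"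
  assumes "convex S"
  assumes deriv: "\<And>n x. x \<in> S \<Longrightarrow> (f n has_vector_derivative f' n x) (at x within S)"
  assumes conv: "uniformly_convergent_on S (\<lambda>n x. \<Sum>i<n. f' i x)"
  assumes "x0 \<in> S" "summable (\<lambda>n. f n x0)" "x \<in> interior S"
  shows "((\<lambda>x. \<Sum>n. f n x) has_vector_derivative (\<Sum>n. f' n x)) (at x)"
proof -
  define g' where "g' = (\<lambda>x. \<Sum>i. f' i x)"
  have lim: "uniform_limit S (\<lambda>n x. \<Sum>i<n. f' i x) g' sequentially"
    using conv by (simp add: uniformly_convergent_uniform_limit_iff suminf_eq_lim g'_def)
  have "\<exists>g. \<forall>x\<in>S. (\<lambda>n. f n x) sums g x \<and> (g has_derivative (\<lambda>h. h *\<^sub>R g' x)) (at x within S)"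
  proof (rule has_derivative_series)
    fix e :: real assume "e > 0"
    from uniform_limitD[OF lim this]
    show "\<forall>\<^sub>F n in sequentially. \<forall>x\<in>S. \<forall>h.
            norm ((\<Sum>i<n. h *\<^sub>R f' i x) - h *\<^sub>R g' x) \<le> e * norm h"
    proof eventually_elim
      case (elim n)
      show ?case
      proof (intro ballI allI)
        fix x h assume "x \<in> S"
        have "norm ((\<Sum>i<n. h *\<^sub>R f' i x) - h *\<^sub>R g' x) = \<bar>h\<bar> * dist (\<Sum>i<n. f' i x) (g' x)"
          by (simp add: dist_norm flip: scaleR_sum_right scaleR_diff_right)
        also have "\<dots> \<le> \<bar>h\<bar> * e"
          using elim \<open>x \<in> S\<close> by (intro mult_left_mono) (auto intro: less_imp_le)
        finally show "norm ((\<Sum>i<n. h *\<^sub>R f' i x) - h *\<^sub>R g' x) \<le> e * norm h"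
          by (simp add: mult.commute)
      qed
    qed
  qed (use assms in \<open>auto simp: has_vector_derivative_def summable_sums\<close>)
  then obtain g where sums: "\<And>x. x \<in> S \<Longrightarrow> (\<lambda>n. f n x) sums g x"
    and g: "\<And>x. x \<in> S \<Longrightarrow> (g has_vector_derivative g' x) (at x within S)"
    unfolding has_vector_derivative_def by blast
  \<comment> \<open>Passing to the open set \<open>interior S\<close> turns the derivative within a
    set into a full derivative at the end.\<close>
  have "(g has_vector_derivative g' x) (at x within interior S)"
    using g \<open>x \<in> interior S\<close> interior_subset by (blast intro: has_vector_derivative_within_subset)
  hence "((\<lambda>x. \<Sum>n. f n x) has_vector_derivative g' x) (at x within interior S)"
    by (rule has_vector_derivative_transform[rotated 2])
       (use sums \<open>x \<in> interior S\<close> interior_subset in \<open>auto simp: sums_iff\<close>)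
  thus ?thesis
    using \<open>x \<in> interior S\<close> by (simp add: at_within_open[OF _ open_interior] g'_def)
qed

text \<open>Convexity of \<open>ln_Gamma\<close>: its graph lies above the tangent at
  \<open>x\<close>, by the mean value theorem and monotonicity of \<open>Digamma\<close>.\<close>

lemma ln_Gamma_real_diff_ge:
  assumes "0 < x" "x \<le> (y :: real)"
  shows "ln_Gamma y - ln_Gamma x \<ge> (y - x) * Digamma x"
proof (cases "x = y")
  case False
  hence "\<exists>\<xi>. x < \<xi> \<and> \<xi> < y \<and> ln_Gamma y - ln_Gamma x = (y - x) * Digamma \<xi>"
    using assms by (intro MVT2 derivative_intros) auto
  thus ?thesis
    using assms by (auto intro!: mult_left_mono Digamma_real_mono)
qed simp

text \<open>The tangent inequality over a unit step, where the functional equation makes the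
  increment of \<open>ln_Gamma\<close> equal to \<open>ln x\<close>.\<close>

lemma Digamma_real_le_ln:
  assumes "(x :: real) > 0"
  shows "Digamma x \<le> ln x"
proof -
  have "Digamma x \<le> ln_Gamma (x + 1) - ln_Gamma x"
    using ln_Gamma_real_diff_ge[of x "x + 1"] assms by simp
  moreover have "Gamma (x + 1) = x * Gamma x"
    using assms by (intro Gamma_plus1) (auto elim!: nonpos_Ints_cases)
  hence "ln_Gamma (x + 1) - ln_Gamma x = ln x"
    using assms Gamma_real_pos[OF assms] by (simp add: ln_Gamma_real_pos ln_mult_pos)
  ultimately show ?thesis by simp
qed

text \<open>\<open>ln_Gamma\<close> lies above its tangent at a point \<open>N\<close> where the
  slope is at least \<open>R + 1\<close>; the surplus slope 1 eventually absorbs the constant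
  term.\<close>

lemma rGamma_real_le_exp: "\<forall>\<^sub>F x :: real in at_top. rGamma x \<le> exp (- R * x)"
proof -
  have "\<forall>\<^sub>F n in sequentially. harm n \<ge> R + 1 + euler_mascheroni"
    using harm_at_top by (simp add: filterlim_at_top)
  then obtain n where n: "harm n \<ge> R + 1 + (euler_mascheroni :: real)"
    by (auto simp: eventually_sequentially)
  \<comment> \<open>\<open>Digamma\<close> at \<open>Suc n\<close> is
    \<open>harm n - euler_mascheroni\<close>, so divergence of the harmonic numbers supplies
    arbitrarily large slopes.\<close>
  define N where "N = real (Suc n)"
  have N: "N > 0" "Digamma N \<ge> R + 1"
    using n unfolding N_def Digamma_of_nat by auto
  show ?thesis
    \<comment> \<open>The second threshold is where the line of slope \<open>R + 1\<close> through
      \<open>(N, ln_Gamma N)\<close> overtakes \<open>R * x\<close>.\<close>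
    using eventually_ge_at_top[of N] eventually_ge_at_top[of "(R + 1) * N - ln_Gamma N"]
  proof eventually_elim
    case (elim x)
    have "(x - N) * (R + 1) \<le> (x - N) * Digamma N"
      using elim N by (intro mult_left_mono) auto
    also have "\<dots> \<le> ln_Gamma x - ln_Gamma N"
      using elim N by (intro ln_Gamma_real_diff_ge)
    finally have "R * x \<le> ln_Gamma x"
      using elim by (simp add: algebra_simps)
    moreover have "rGamma x = exp (- ln_Gamma x)"
      using elim N by (simp add: rGamma_inverse_Gamma Gamma_real_pos_exp exp_minus)
    ultimately show ?case by simp
  qed
qed

text \<open>Since \<open>Digamma x \<le> ln x < x < exp x\<close>, the extra factor costs one unit
  of the decay rate. Restricting to \<open>x \<ge> 2\<close> makes \<open>Digamma x\<close>
  positive.\<close>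

lemma Digamma_rGamma_real_le_exp:
  "\<forall>\<^sub>F x :: real in at_top. \<bar>Digamma x * rGamma x\<bar> \<le> exp (- R * x)"
  using rGamma_real_le_exp[of "R + 1"] eventually_ge_at_top[of 2]
proof eventually_elim
  case (elim x)
  have "Digamma x > 0" "Gamma x > 0"
    using elim by (auto intro: Digamma_real_ge_three_halves_pos)
  moreover have "Digamma x \<le> exp x"
    using Digamma_real_le_ln[of x] ln_less_self[of x] exp_ge_add_one_self[of x] elim by linarith
  ultimately have "\<bar>Digamma x * rGamma x\<bar> \<le> exp x * exp (- (R + 1) * x)"
    using elim by (auto simp: abs_mult rGamma_inverse_Gamma intro!: mult_mono)
  also have "\<dots> = exp (- R * x)"
    by (simp add: algebra_simps flip: exp_add)
  finally show ?case .
qed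

text \<open>Stated for a general \<open>g\<close> because it serves both the series itself
  (\<open>rGamma\<close>) and the series of derivatives (\<open>Digamma\<close> times
  \<open>rGamma\<close>).\<close>

lemma superexponential_decay_imp_geometric_bound:
  fixes g :: "real \<Rightarrow> real"
  assumes decay: "\<And>R. \<forall>\<^sub>F x in at_top. \<bar>g x\<bar> \<le> exp (- R * x)"
  assumes "c > 0" "\<beta> \<ge> 0" "r \<ge> 0"
  shows "\<forall>\<^sub>F k in sequentially. \<forall>a\<in>{c..}. real k * \<bar>g (a * real k + \<beta>)\<bar> * r ^ k \<le> (1 / 2) ^ k"
proof -
  \<comment> \<open>One factor 2 in \<open>q\<close> absorbs \<open>real k \<le> 2 ^ k\<close>, the
    other leaves the ratio 1/2. Using \<open>r + 1\<close> keeps \<open>q > 1\<close> even for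
    \<open>r = 0\<close>, so \<open>R \<ge> 0\<close>; the choice of \<open>R\<close> makes
    \<open>exp (- R * c)\<close> equal to \<open>1 / q\<close>.\<close>
  define q where "q = 4 * (r + 1)"
  define R where "R = ln q / c"
  have "R \<ge> 0"
    using assms by (auto simp: R_def q_def)
  obtain X where X: "\<And>x. x \<ge> X \<Longrightarrow> \<bar>g x\<bar> \<le> exp (- R * x)"
    using decay[of R] by (auto simp: eventually_at_top_linorder)
  show ?thesis
    using eventually_ge_at_top[of "nat \<lceil>X / c\<rceil>"]
  proof eventually_elim
    case (elim k)
    hence k: "c * real k \<ge> X"
      using \<open>c > 0\<close> by (simp add: nat_ceiling_le_eq field_simps)
    show ?case
    proof
      fix a assume "a \<in> {c..}"
      hence x: "a * real k + \<beta> \<ge> c * real k"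
        using assms by (simp add: add_increasing2 mult_right_mono)
      hence "\<bar>g (a * real k + \<beta>)\<bar> \<le> exp (- R * (a * real k + \<beta>))"
        using k by (intro X) linarith
      also have "\<dots> \<le> exp (- R * (c * real k))"
        using mult_left_mono[OF x \<open>R \<ge> 0\<close>] by simp
      also have "\<dots> = exp (real k * (- ln q))"
        using \<open>c > 0\<close> by (simp add: R_def)
      also have "\<dots> = (1 / q) ^ k"
        using assms by (subst exp_of_nat_mult) (simp add: q_def exp_minus field_simps)
      finally have g: "\<bar>g (a * real k + \<beta>)\<bar> \<le> (1 / q) ^ k" .
      have "real k \<le> 2 ^ k"
        by (rule less_imp_le[OF of_nat_less_two_power])
      hence "real k * \<bar>g (a * real k + \<beta>)\<bar> * r ^ k \<le> 2 ^ k * (1 / q) ^ k * r ^ k"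
        using g assms by (intro mult_mono) auto
      also have "\<dots> = (2 * r / q) ^ k"
        by (simp add: power_mult_distrib power_divide)
      also have "\<dots> \<le> (1 / 2) ^ k"
        using assms by (intro power_mono) (auto simp: q_def field_simps)
      finally show "real k * \<bar>g (a * real k + \<beta>)\<bar> * r ^ k \<le> (1 / 2) ^ k" .
    qed
  qed
qed

text \<open>A real scalar times \<open>z ^ k\<close> lets the real estimates apply. The case
  \<open>k = 0\<close> is separate because \<open>\<beta>\<close> may be the pole 0; there the
  factor \<open>k\<close> makes both sides vanish.\<close>

lemma ml_deriv_term_altdef:
  assumes "a > 0" "\<beta> \<ge> 0"
  shows "ml_deriv_term a \<beta> z k =
           (real k * (Digamma (a * real k + \<beta>) * rGamma (a * real k + \<beta>))) *\<^sub>R z ^ k"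
proof (cases "k = 0")
  case False
  hence "a * real k + \<beta> > 0"
    using assms by (simp add: add_pos_nonneg)
  hence "Digamma (complex_of_real (a * real k + \<beta>)) = of_real (Digamma (a * real k + \<beta>))"
    by (intro Polygamma_of_real) simp
  thus ?thesis
    unfolding ml_deriv_term_def Gamma_complex_of_real
    by (simp add: rGamma_inverse_Gamma scaleR_conv_of_real divide_inverse mult_ac)
qed (simp add: ml_deriv_term_def)

theorem proposition2p1:
  fixes \<alpha> \<beta> :: real and z :: complex
  assumes "\<beta> \<ge> 0" and "\<alpha> > 0"
  shows "summable (\<lambda>n. ml_deriv_term \<alpha> \<beta> z (Suc n)) \<and>
         ((\<lambda>a. mittag_leffler (complex_of_real a) (complex_of_real \<beta>) z)
            has_vector_derivative - (\<Sum>n. ml_deriv_term \<alpha> \<beta> z (Suc n))) (at \<alpha>)"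
proof -
  \<comment> \<open>Staying away from 0 gives bounds uniform in \<open>a\<close>, while
    \<open>\<alpha>\<close> remains an interior point.\<close>
  define S where "S = {\<alpha> / 2..}"
  define f :: "nat \<Rightarrow> real \<Rightarrow> complex" where "f = (\<lambda>k a. rGamma (a * real k + \<beta>) *\<^sub>R z ^ k)"
  define f' where "f' = (\<lambda>k a. - ml_deriv_term a \<beta> z k)"
  have S: "\<alpha> \<in> S" "\<alpha> \<in> interior S" "convex S"
    using \<open>\<alpha> > 0\<close> by (auto simp: S_def)
  have S_pos: "a > 0" if "a \<in> S" for a
    using that \<open>\<alpha> > 0\<close> by (auto simp: S_def)
  have geometric: "summable (\<lambda>k. (1 / 2 :: real) ^ k)"
    by simp

  have bound_f': "\<forall>\<^sub>F k in sequentially. \<forall>a\<in>S. norm (f' k a) \<le> (1 / 2) ^ k"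
    using superexponential_decay_imp_geometric_bound
            [OF Digamma_rGamma_real_le_exp, of "\<alpha> / 2" \<beta> "norm z"] assms
    by (auto simp: f'_def S_def ml_deriv_term_altdef norm_power abs_mult elim!: eventually_mono)
  have conv: "uniformly_convergent_on S (\<lambda>n a. \<Sum>k<n. f' k a)"
    using bound_f' geometric by (rule Weierstrass_m_test'_ev)
  have summable_f': "summable (\<lambda>k. f' k \<alpha>)"
    using bound_f' S(1) by (intro summable_comparison_test_ev[OF _ geometric]) (auto elim: eventually_mono)

  have "\<forall>\<^sub>F x in at_top. \<bar>rGamma x\<bar> \<le> exp (- R * x)" for R :: real
    using rGamma_real_le_exp[of R] eventually_gt_at_top[of 0]
    by eventually_elim (simp add: rGamma_inverse_Gamma)
  from superexponential_decay_imp_geometric_bound[OF this, of "\<alpha> / 2" \<beta> "norm z"]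
  have "\<forall>\<^sub>F k in sequentially. \<forall>a\<in>S. real k * norm (f k a) \<le> (1 / 2) ^ k"
    using assms by (simp add: S_def f_def norm_power mult.assoc)
  hence "\<forall>\<^sub>F k in sequentially. norm (f k \<alpha>) \<le> (1 / 2) ^ k"
    using eventually_gt_at_top[of 0]
  proof eventually_elim
    case (elim k)
    have "norm (f k \<alpha>) \<le> real k * norm (f k \<alpha>)"
      using elim by (simp add: mult_le_cancel_right1)
    thus ?case
      using elim S(1) by force
  qed
  hence summable_f: "summable (\<lambda>k. f k \<alpha>)"
    by (rule summable_comparison_test_ev[OF _ geometric])

  have deriv: "(f k has_vector_derivative f' k a) (at a within S)" if "a \<in> S" for k a
  proof (cases "k = 0")
    \<comment> \<open>The zeroth term does not depend on \<open>a\<close>, so the argument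
      \<open>\<beta>\<close>, possibly a pole of \<open>Digamma\<close>, needs no
      differentiation.\<close>
    case True
    thus ?thesis by (simp add: f_def f'_def ml_deriv_term_def)
  next
    case False
    hence "a * real k + \<beta> > 0"
      using S_pos[OF that] assms by (simp add: add_pos_nonneg)
    hence "((\<lambda>a. rGamma (a * real k + \<beta>)) has_field_derivative
             - (real k * (Digamma (a * real k + \<beta>) * rGamma (a * real k + \<beta>)))) (at a within S)"
      by (auto intro!: derivative_eq_intros elim!: nonpos_Ints_cases)
    from has_vector_derivative_scaleR[OF this has_vector_derivative_const[of "z ^ k"]]
    show ?thesis
      using S_pos[OF that] assms by (simp add: f_def f'_def ml_deriv_term_altdef)
  qed

  have "(\<lambda>a. mittag_leffler (complex_of_real a) (complex_of_real \<beta>) z) = (\<lambda>a. \<Sum>k. f k a)"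
    by (simp add: mittag_leffler_def f_def scaleR_conv_of_real mult.commute
             flip: rGamma_complex_of_real)
  moreover have "(\<Sum>k. f' k \<alpha>) = - (\<Sum>n. ml_deriv_term \<alpha> \<beta> z (Suc n))"
    and "summable (\<lambda>n. ml_deriv_term \<alpha> \<beta> z (Suc n))"
  proof -
    have summ: "summable (ml_deriv_term \<alpha> \<beta> z)"
      using summable_f' by (simp add: f'_def summable_minus_iff)
    thus "summable (\<lambda>n. ml_deriv_term \<alpha> \<beta> z (Suc n))"
      by (simp add: summable_Suc_iff)
    \<comment> \<open>This reconciles the termwise sum from 0 with the claimed sum from 1.\<close>
    have "ml_deriv_term \<alpha> \<beta> z 0 = 0"
      by (simp add: ml_deriv_term_def)
    thus "(\<Sum>k. f' k \<alpha>) = - (\<Sum>n. ml_deriv_term \<alpha> \<beta> z (Suc n))"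
      using suminf_split_head[OF summ] suminf_minus[OF summ]
      by (simp add: f'_def)
  qed
  ultimately show ?thesis
    using has_vector_derivative_series[OF S(3) deriv conv S(1) summable_f S(2)] by simp
qed

end
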